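(* Consider the $T_{LNB}$ model with parameters $c_1,c_2,c_3>0$, $k>0$ such that $E_2$ has strictly positive coordinates. The bifurcation parameter surface of the Neimark-Sacker bifurcation at $E_2$ is $NS_{LNB}=0$. Furthermore, if a Neimark-Sacker bifurcation occurs at $E_2$, the following transversality condition should be satisfied: $$NT_{LNB}^k\neq0,\quad NT_{LNB}^{c_1}\neq0,\quad NT_{LNB}^{c_2}\neq0,\quad NT_{LNB}^{c_3}\neq0.$$ The polynomials $NS_{LNB}$, $NT_{LNB}^k$, $NT_{LNB}^{c_1}$, $NT_{LNB}^{c_2}$, $NT_{LNB}^{c_3}$ in $k,c_1,c_2,c_3$ are the explicit ones written out in the context.
   Context: The $T_{LNB}$ model is the 3-dimensional discrete dynamical system $$\begin{aligned}x(t+1)&=\tfrac12\left[2x(t)+y(t)+z(t)-c_1\big(x(t)+y(t)+z(t)\big)^2\right],\\ y(t+1)&=\sqrt{\tfrac{x(t)+z(t)}{c_2}}-x(t)-z(t),\\ z(t+1)&=z(t)+kz(t)\left[\tfrac{x(t)+y(t)}{(x(t)+y(t)+z(t))^2}-c_3\right],\end{aligned}$$ with equilibrium $$E_2=\left(\frac{2(c_2+c_3-c_1)}{(c_1+c_2+c_3)^2},\frac{2(c_1+c_3-c_2)}{(c_1+c_2+c_3)^2},\frac{2(c_1+c_2-c_3)}{(c_1+c_2+c_3)^2}\right).$$ Write $\boldsymbol u=(k,c_1,c_2,c_3)$ for the parameters, let $\lambda^3+a_2\lambda^2+a_1\lambda+a_0$, with $a_i=a_i(\boldsymbol u)$, be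 the characteristic polynomial of the Jacobian matrix of the iteration map at $E_2$, and put $D_2^-=-a_0^2+a_0a_2-a_1+1$. A Neimark-Sacker bifurcation takes place at a parameter point $\overline{\boldsymbol u}$ if and only if: (1) eigenvalue assignment: the Jacobian matrix at the equilibrium has a pair of complex conjugate eigenvalues $\lambda_1(\overline{\boldsymbol u}),\lambda_2(\overline{\boldsymbol u})$ with $|\lambda_1(\overline{\boldsymbol u})|=|\lambda_2(\overline{\boldsymbol u})|=1$, and all other eigenvalues satisfy $|\lambda_j(\overline{\boldsymbol u})|<1$; (2) transversality: $\partial|\lambda_1(\boldsymbol u)|/\partial u_j\neq0$ at $\boldsymbol u=\overline{\boldsymbol u}$ for every parameter $u_j$. In terms of the coefficients, the criterion used is: $1+a_2+a_1+a_0>0$, $-1+a_2-a_1+a_0<0$, $-a_0^2-a_0a_2+a_1+1>0$, $D_2^-=0$, and $\partial D_2^-/\partial u_j\neq0$ at $\boldsymbol u=\overline{\boldsymbol u}$ for every parameter $u_j$. The bifurcation parameter surface of the Neimark-Sacker bifurcation is the surface in parameter space determined by $D_2^-=0$ at $E_2$. Explicit polynomials: $NS_{LNB}=$ $4k^2c_3^6$ $+(-8c_1k^2+4k)c_3^5$ $+(-4c_1^2k^2+16c_1c_2k^2-72c_2^2k^2-12c_1k+1)c_3^4$ $+(16c_1^3k^2-32c_1^2c_2k^2+112c_1c_2^2k^2+128c_2^3k^2-8c_1^2k+8c_1c_2k+48c_2^2k-4c_1+4c_2)c_3^3$ $+(-4c_1^4k^2-16c_1^2c_2^2k^2-144c_1c_2^3k^2-60c_2^4k^2+24c_1^3k-56c_1^2c_2k+136c_1c_2^2k-8c_2^3k-2c_1^2+4c_1c_2-10c_2^2)c_3^2$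 $+(-8c_1^5k^2+32c_1^4c_2k^2-16c_1^3c_2^2k^2-32c_1^2c_2^3k^2+24c_1c_2^4k^2+4c_1^4k-8c_1^3c_2k-80c_1^2c_2^2k-248c_1c_2^3k-52c_2^4k+12c_1^3-36c_1^2c_2-76c_2^2c_1-28c_2^3)c_3$ $+4c_1^6k^2-16c_1^5c_2k^2-8c_1^4c_2^2k^2+48c_1^3c_2^3k^2+36c_1^2c_2^4k^2-12c_1^5k+56c_1^4c_2k+24c_1^3c_2^2k-32c_1^2c_2^3k+20c_1c_2^4k+8c_2^5k+9c_1^4-36c_1^3c_2-114c_1^2c_2^2-84c_1c_2^3-15c_2^4$. $NT_{LNB}^k=$ $2kc_1^5$ $+(-10c_2k-2c_3k-3)c_1^4$ $+(6c_2^2k+8c_2c_3k-4c_3^2k+17c_2-2c_3)c_1^3$ $+(18c_2^3k-10c_2^2c_3k+12c_2c_3^2k+4kc_3^3-11c_2^2+17c_3c_2+4c_3^2)c_1^2$ $+(12c_2^3c_3k-30c_2^2c_3^2k-8c_2c_3^3k+2c_3^4k+3c_2^3-48c_2^2c_3-c_2c_3^2+2c_3^3)c_1$ $-30c_2^3c_3^2k+34c_2^2c_3^3k-2c_2c_3^4k-2c_3^5k+2c_2^4-11c_2^3c_3-13c_2^2c_3^2-c_2c_3^3-c_3^4$. $NT_{LNB}^{c_1}=$ $2k^2c_1^5$ $+(-8k^2c_2-2k^2c_3-7k)c_1^4$ $+(-4c_2^2k^2+16k^2c_3c_2-4k^2c_3^2+28kc_2-2c_3k+6)c_1^3$ $+(24c_2^3k^2-20c_2^2c_3k^2+4c_3^3k^2+14c_2^2k-6kc_3c_2+12c_3^2k-18c_2+10c_3)c_1^2$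 $+(18c_2^4k^2-32c_2^3c_3k^2+28c_2^2c_3^2k^2-16c_2c_3^3k^2+2c_3^4k^2-20c_2^3k+26c_2^2c_3k-32c_2c_3^2k+2kc_3^3-38c_2^2-20c_3c_2+2c_3^2)c_1$ $+6c_2^4c_3k^2-8c_2^3c_3^2k^2-4c_2^2c_3^3k^2+8c_2c_3^4k^2-2c_3^5k^2+c_2^4k-34c_2^3c_3k+36c_2^2c_3^2k+2c_2c_3^3k-5c_3^4k-14c_2^3-14c_2^2c_3-2c_2c_3^2-2c_3^3$. $NT_{LNB}^{c_2}=$ $4k^2c_1^5$ $+(-4c_2k^2-12c_3k^2-12k)c_1^4$ $+(-20c_2^2k^2+16c_2c_3k^2+8c_3^2k^2+24kc_2+16c_3k+9)c_1^3$ $+(-12c_2^3k^2+36c_2^2c_3k^2-24c_2c_3^2k^2+8c_3^3k^2+32c_2^2k-32c_2c_3k+8c_3^2k-21c_2+3c_3)c_1^2$ $+(8c_2^3c_3k^2-12c_2^2c_3^2k^2+16c_2c_3^3k^2-12c_3^4k^2-8c_2^3k+8c_2c_3^2k-16kc_3^3+3c_2^2-2c_3c_2-5c_3^2)c_1$ $+4c_2^3c_3^2k^2-4c_2^2c_3^3k^2-4c_2c_3^4k^2+4c_3^5k^2-4c_2^4k+4c_3^4k+c_2^3+3c_2^2c_3+3c_2c_3^2+c_3^3$. $NT_{LNB}^{c_3}=$ $6kc_1^5$ $+(-40c_2k-2kc_3-9)c_1^4$ $+(36c_2^2k+28c_2c_3k-12c_3^2k+72c_2-12c_3)c_1^3$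 $+(88c_2^3k-96c_2^2c_3k+44c_2c_3^2k+4kc_3^3-90c_2^2+72c_3c_2+2c_3^2)c_1^2$ $+(6c_2^4k-28c_2^3c_3k-4c_2^2c_3^2k-28c_2c_3^3k+6c_3^4k-48c_2^3-60c_2^2c_3-8c_2c_3^2+4c_3^3)c_1$ $-30c_2^4c_3k+4c_2^3c_3^2k+32c_2^2c_3^3k-4c_2c_3^4k-2c_3^5k-5c_2^4-16c_2^3c_3-18c_2^2c_3^2-8c_2c_3^3-c_3^4$.
   Formalization: In the transversality conditions the partial derivatives of D_2^- and |λ_1| in each parameter are taken with the state held fixed at E_2, not following E_2 as the parameters vary; with the moving equilibrium the claim fails (NT^{c_3} can vanish at a Neimark-Sacker point). *)

theory Defs
  imports "HOL-Analysis.Analysis" "HOL-Computational_Algebra.Polynomial"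
begin

definition charpoly :: "'a::comm_ring_1 ^ 'n ^ 'n \<Rightarrow> 'a poly" where
  "charpoly A = det (mat [:0, 1:] - map_matrix (\<lambda>a. [:a:]) A)"

definition complex_eigenvalues :: "real ^ 'n ^ 'n \<Rightarrow> complex set" where
  "complex_eigenvalues A =
     {\<mu>. \<exists>w :: complex ^ 'n. w \<noteq> 0 \<and> map_matrix complex_of_real A *v w = \<mu> *s w}"

definition nonzero_partials :: "(real ^ 'm \<Rightarrow> real) \<Rightarrow> real ^ 'm \<Rightarrow> bool" where
  "nonzero_partials f u \<longleftrightarrow>
     (\<forall>j. \<exists>d. d \<noteq> 0 \<and> ((\<lambda>t. f (u + t *\<^sub>R axis j 1)) has_real_derivative d) (at 0))"

text \<open>
  \<open>ev\<close> is a continuous branch of eigenvalues in the parameters near \<open>u\<close>.  The matrices are real, so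
  \<open>cnj (ev u)\<close> is an eigenvalue as well; the pair is required to be non-real, hence in dimension 3
  both members are simple and the condition on the rest of the spectrum loses no multiplicities.
\<close>

definition neimark_sacker :: "(real ^ 'm \<Rightarrow> real ^ 3 ^ 3) \<Rightarrow> real ^ 'm \<Rightarrow> bool" where
  "neimark_sacker A u \<longleftrightarrow>
     (\<exists>U ev. open U \<and> u \<in> U \<and> continuous_on U ev \<and>
        (\<forall>v\<in>U. ev v \<in> complex_eigenvalues (A v)) \<and>
        Im (ev u) \<noteq> 0 \<and> cmod (ev u) = 1 \<and>
        (\<forall>\<mu> \<in> complex_eigenvalues (A u) - {ev u, cnj (ev u)}. cmod \<mu> < 1) \<and>
        nonzero_partials (\<lambda>v. cmod (ev v)) u)"

definition D2_minus :: "real ^ 3 ^ 3 \<Rightarrow> real" where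
  "D2_minus M = (let a = coeff (charpoly M) in - (a 0)\<^sup>2 + a 0 * a 2 - a 1 + 1)"

definition neimark_sacker_criterion :: "(real ^ 'm \<Rightarrow> real ^ 3 ^ 3) \<Rightarrow> real ^ 'm \<Rightarrow> bool" where
  "neimark_sacker_criterion A u \<longleftrightarrow>
     (let a = coeff (charpoly (A u)) in
        1 + a 2 + a 1 + a 0 > 0 \<and>
        - 1 + a 2 - a 1 + a 0 < 0 \<and>
        - (a 0)\<^sup>2 - a 0 * a 2 + a 1 + 1 > 0 \<and>
        D2_minus (A u) = 0 \<and>
        nonzero_partials (\<lambda>v. D2_minus (A v)) u)"

text \<open>The parameter vector is \<open>u = (k, c1, c2, c3)\<close>, the state is \<open>p = (x, y, z)\<close>.\<close>

definition LNB_map :: "real ^ 4 \<Rightarrow> real ^ 3 \<Rightarrow> real ^ 3" where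
  "LNB_map u p =
     (let k = u $ 1; c1 = u $ 2; c2 = u $ 3; c3 = u $ 4; x = p $ 1; y = p $ 2; z = p $ 3 in
      vector
        [1 / 2 * (2 * x + y + z - c1 * (x + y + z)\<^sup>2),
         sqrt ((x + z) / c2) - x - z,
         z + k * z * ((x + y) / (x + y + z)\<^sup>2 - c3)])"

definition LNB_E2 :: "real ^ 4 \<Rightarrow> real ^ 3" where
  "LNB_E2 u =
     (let c1 = u $ 2; c2 = u $ 3; c3 = u $ 4 in
      vector
        [2 * (c2 + c3 - c1) / (c1 + c2 + c3)\<^sup>2,
         2 * (c1 + c3 - c2) / (c1 + c2 + c3)\<^sup>2,
         2 * (c1 + c2 - c3) / (c1 + c2 + c3)\<^sup>2])"

definition LNB_admissible :: "real ^ 4 \<Rightarrow> bool" where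
  "LNB_admissible u \<longleftrightarrow> (\<forall>j. u $ j > 0) \<and> (\<forall>i. LNB_E2 u $ i > 0)"

definition LNB_jacobian :: "real ^ 4 \<Rightarrow> real ^ 3 \<Rightarrow> real ^ 3 ^ 3" where
  "LNB_jacobian u p = jacobian (LNB_map u) (at p)"

text \<open>
  The quantities differentiated in the transversality conditions are functions of the parameters
  and of the state, evaluated at \<open>E2\<close>; the partial derivative with respect to a parameter is taken
  with the state held at its value \<open>E2 u\<close>.  This is the derivative whose numerators are the
  polynomials \<open>NT_LNB\<close> below (it is not the total derivative along the moving equilibrium,
  which differs from it for \<open>c1, c2, c3\<close>): writing \<open>s = c1 + c2 + c3\<close>, the four partial derivatives of
  \<open>D2_minus\<close> of this family at \<open>u\<close> are
  \<open>- (c1 + c2 - c3) NT_LNB_k / (16 c2^2 s^2)\<close>, \<open>- NT_LNB_c1 / (16 c2^2 s^2)\<close>,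
  \<open>NT_LNB_c2 / (64 c2^3 s)\<close> and \<open>- k NT_LNB_c3 / (32 c2^2 s^2)\<close>.
\<close>

definition LNB_jacobian_family :: "real ^ 4 \<Rightarrow> real ^ 4 \<Rightarrow> real ^ 3 ^ 3" where
  "LNB_jacobian_family u v = LNB_jacobian v (LNB_E2 u)"

definition NS_LNB :: "real ^ 4 \<Rightarrow> real" where
  "NS_LNB u = (let k = u $ 1; c1 = u $ 2; c2 = u $ 3; c3 = u $ 4 in
    4 * k^2 * c3^6
    + (- 8 * c1 * k^2 + 4 * k) * c3^5
    + (- 4 * c1^2 * k^2 + 16 * c1 * c2 * k^2 - 72 * c2^2 * k^2 - 12 * c1 * k + 1) * c3^4
    + (16 * c1^3 * k^2 - 32 * c1^2 * c2 * k^2 + 112 * c1 * c2^2 * k^2 + 128 * c2^3 * k^2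
        - 8 * c1^2 * k + 8 * c1 * c2 * k + 48 * c2^2 * k - 4 * c1 + 4 * c2) * c3^3
    + (- 4 * c1^4 * k^2 - 16 * c1^2 * c2^2 * k^2 - 144 * c1 * c2^3 * k^2 - 60 * c2^4 * k^2
        + 24 * c1^3 * k - 56 * c1^2 * c2 * k + 136 * c1 * c2^2 * k - 8 * c2^3 * k - 2 * c1^2
        + 4 * c1 * c2 - 10 * c2^2) * c3^2
    + (- 8 * c1^5 * k^2 + 32 * c1^4 * c2 * k^2 - 16 * c1^3 * c2^2 * k^2 - 32 * c1^2 * c2^3 * k^2
        + 24 * c1 * c2^4 * k^2 + 4 * c1^4 * k - 8 * c1^3 * c2 * k - 80 * c1^2 * c2^2 * k
        - 248 * c1 * c2^3 * k - 52 * c2^4 * k + 12 * c1^3 - 36 * c1^2 * c2 - 76 * c2^2 * c1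
        - 28 * c2^3) * c3
    + 4 * c1^6 * k^2 - 16 * c1^5 * c2 * k^2 - 8 * c1^4 * c2^2 * k^2 + 48 * c1^3 * c2^3 * k^2
        + 36 * c1^2 * c2^4 * k^2 - 12 * c1^5 * k + 56 * c1^4 * c2 * k + 24 * c1^3 * c2^2 * k
        - 32 * c1^2 * c2^3 * k + 20 * c1 * c2^4 * k + 8 * c2^5 * k + 9 * c1^4 - 36 * c1^3 * c2
        - 114 * c1^2 * c2^2 - 84 * c1 * c2^3 - 15 * c2^4)"

definition NT_LNB_k :: "real ^ 4 \<Rightarrow> real" where
  "NT_LNB_k u = (let k = u $ 1; c1 = u $ 2; c2 = u $ 3; c3 = u $ 4 in
    2 * k * c1^5
    + (- 10 * c2 * k - 2 * c3 * k - 3) * c1^4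
    + (6 * c2^2 * k + 8 * c2 * c3 * k - 4 * c3^2 * k + 17 * c2 - 2 * c3) * c1^3
    + (18 * c2^3 * k - 10 * c2^2 * c3 * k + 12 * c2 * c3^2 * k + 4 * k * c3^3 - 11 * c2^2
        + 17 * c3 * c2 + 4 * c3^2) * c1^2
    + (12 * c2^3 * c3 * k - 30 * c2^2 * c3^2 * k - 8 * c2 * c3^3 * k + 2 * c3^4 * k + 3 * c2^3
        - 48 * c2^2 * c3 - c2 * c3^2 + 2 * c3^3) * c1
    - 30 * c2^3 * c3^2 * k + 34 * c2^2 * c3^3 * k - 2 * c2 * c3^4 * k - 2 * c3^5 * k + 2 * c2^4
        - 11 * c2^3 * c3 - 13 * c2^2 * c3^2 - c2 * c3^3 - c3^4)"

definition NT_LNB_c1 :: "real ^ 4 \<Rightarrow> real" where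
  "NT_LNB_c1 u = (let k = u $ 1; c1 = u $ 2; c2 = u $ 3; c3 = u $ 4 in
    2 * k^2 * c1^5
    + (- 8 * k^2 * c2 - 2 * k^2 * c3 - 7 * k) * c1^4
    + (- 4 * c2^2 * k^2 + 16 * k^2 * c3 * c2 - 4 * k^2 * c3^2 + 28 * k * c2 - 2 * c3 * k
        + 6) * c1^3
    + (24 * c2^3 * k^2 - 20 * c2^2 * c3 * k^2 + 4 * c3^3 * k^2 + 14 * c2^2 * k - 6 * k * c3 * c2
        + 12 * c3^2 * k - 18 * c2 + 10 * c3) * c1^2
    + (18 * c2^4 * k^2 - 32 * c2^3 * c3 * k^2 + 28 * c2^2 * c3^2 * k^2 - 16 * c2 * c3^3 * k^2
        + 2 * c3^4 * k^2 - 20 * c2^3 * k + 26 * c2^2 * c3 * k - 32 * c2 * c3^2 * k + 2 * k * c3^3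
        - 38 * c2^2 - 20 * c3 * c2 + 2 * c3^2) * c1
    + 6 * c2^4 * c3 * k^2 - 8 * c2^3 * c3^2 * k^2 - 4 * c2^2 * c3^3 * k^2 + 8 * c2 * c3^4 * k^2
        - 2 * c3^5 * k^2 + c2^4 * k - 34 * c2^3 * c3 * k + 36 * c2^2 * c3^2 * k
        + 2 * c2 * c3^3 * k - 5 * c3^4 * k - 14 * c2^3 - 14 * c2^2 * c3 - 2 * c2 * c3^2
        - 2 * c3^3)"

definition NT_LNB_c2 :: "real ^ 4 \<Rightarrow> real" where
  "NT_LNB_c2 u = (let k = u $ 1; c1 = u $ 2; c2 = u $ 3; c3 = u $ 4 in
    4 * k^2 * c1^5
    + (- 4 * c2 * k^2 - 12 * c3 * k^2 - 12 * k) * c1^4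
    + (- 20 * c2^2 * k^2 + 16 * c2 * c3 * k^2 + 8 * c3^2 * k^2 + 24 * k * c2 + 16 * c3 * k
        + 9) * c1^3
    + (- 12 * c2^3 * k^2 + 36 * c2^2 * c3 * k^2 - 24 * c2 * c3^2 * k^2 + 8 * c3^3 * k^2
        + 32 * c2^2 * k - 32 * c2 * c3 * k + 8 * c3^2 * k - 21 * c2 + 3 * c3) * c1^2
    + (8 * c2^3 * c3 * k^2 - 12 * c2^2 * c3^2 * k^2 + 16 * c2 * c3^3 * k^2 - 12 * c3^4 * k^2
        - 8 * c2^3 * k + 8 * c2 * c3^2 * k - 16 * k * c3^3 + 3 * c2^2 - 2 * c3 * c2
        - 5 * c3^2) * c1
    + 4 * c2^3 * c3^2 * k^2 - 4 * c2^2 * c3^3 * k^2 - 4 * c2 * c3^4 * k^2 + 4 * c3^5 * k^2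
        - 4 * c2^4 * k + 4 * c3^4 * k + c2^3 + 3 * c2^2 * c3 + 3 * c2 * c3^2 + c3^3)"

definition NT_LNB_c3 :: "real ^ 4 \<Rightarrow> real" where
  "NT_LNB_c3 u = (let k = u $ 1; c1 = u $ 2; c2 = u $ 3; c3 = u $ 4 in
    6 * k * c1^5
    + (- 40 * c2 * k - 2 * k * c3 - 9) * c1^4
    + (36 * c2^2 * k + 28 * c2 * c3 * k - 12 * c3^2 * k + 72 * c2 - 12 * c3) * c1^3
    + (88 * c2^3 * k - 96 * c2^2 * c3 * k + 44 * c2 * c3^2 * k + 4 * k * c3^3 - 90 * c2^2
        + 72 * c3 * c2 + 2 * c3^2) * c1^2
    + (6 * c2^4 * k - 28 * c2^3 * c3 * k - 4 * c2^2 * c3^2 * k - 28 * c2 * c3^3 * k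
        + 6 * c3^4 * k - 48 * c2^3 - 60 * c2^2 * c3 - 8 * c2 * c3^2 + 4 * c3^3) * c1
    - 30 * c2^4 * c3 * k + 4 * c2^3 * c3^2 * k + 32 * c2^2 * c3^3 * k - 4 * c2 * c3^4 * k
        - 2 * c3^5 * k - 5 * c2^4 - 16 * c2^3 * c3 - 18 * c2^2 * c3^2 - 8 * c2 * c3^3 - c3^4)"

lemma LNB_E2_fixed_point:
  assumes "LNB_admissible u"
  shows "LNB_map u (LNB_E2 u) = LNB_E2 u"
proof -
  define c1 c2 c3 s where "c1 = u $ 2" and "c2 = u $ 3" and "c3 = u $ 4" and "s = c1 + c2 + c3"
  have pos: "c1 > 0" "c2 > 0" "c3 > 0"
    using assms by (auto simp: LNB_admissible_def c1_def c2_def c3_def)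
  then have s: "s > 0" by (simp add: s_def)
  define x y z where "x = LNB_E2 u $ 1" and "y = LNB_E2 u $ 2" and "z = LNB_E2 u $ 3"
  have E: "x = 2 * (s - 2 * c1) / s\<^sup>2" "y = 2 * (s - 2 * c2) / s\<^sup>2" "z = 2 * (s - 2 * c3) / s\<^sup>2"
    by (simp_all add: x_def y_def z_def LNB_E2_def Let_def s_def c1_def c2_def c3_def algebra_simps)
  have S: "x + y + z = 2 / s"
  proof -
    have "x + y + z = 2 * (3 * s - 2 * (c1 + c2 + c3)) / s\<^sup>2"
      by (simp add: E add_divide_distrib[symmetric] algebra_simps)
    also have "\<dots> = 2 / s" using s by (simp add: s_def[symmetric] power2_eq_square)
    finally show ?thesis .
  qed
  have xz: "x + z = 4 * c2 / s\<^sup>2" and xy: "x + y = 4 * c3 / s\<^sup>2" and yz: "y + z = 4 * c1 / s\<^sup>2"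
    by (simp_all add: E s_def add_divide_distrib[symmetric] algebra_simps)
  have 1: "1 / 2 * (2 * x + y + z - c1 * (x + y + z)\<^sup>2) = x"
  proof -
    have "c1 * (x + y + z)\<^sup>2 = y + z"
      unfolding S yz using s by (simp add: power_divide)
    then show ?thesis by simp
  qed
  have 2: "sqrt ((x + z) / c2) - x - z = y"
  proof -
    have "(x + z) / c2 = (2 / s)\<^sup>2" unfolding xz using pos by (simp add: power_divide)
    then have "sqrt ((x + z) / c2) = 2 / s" using s by simp
    then show ?thesis using S by simp
  qed
  have 3: "(x + y) / (x + y + z)\<^sup>2 - c3 = 0"
    by (subst S, subst xy) (use s in \<open>simp add: power_divide\<close>)
  have "LNB_map u (LNB_E2 u) = vector [x, y, z]"
    unfolding LNB_map_def Let_def c1_def[symmetric] c2_def[symmetric] c3_def[symmetric]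
      x_def[symmetric] y_def[symmetric] z_def[symmetric] 1 2 3 by simp
  also have "\<dots> = LNB_E2 u"
    by (simp add: vec_eq_iff forall_3 x_def y_def z_def)
  finally show ?thesis .
qed

end

theory Submission
  imports Defs
begin

text \<open>
  At \<open>E2\<close> with \<open>s = c1 + c2 + c3\<close> the entries of the Jacobian are rational with denominators
  \<open>s\<close> and \<open>4 c2\<close>, and the coefficients of its characteristic polynomial acquire
  the common denominator \<open>8 c2 s\<close>; after multiplication by its square, \<open>D2_minus\<close> and its partial
  derivatives become the polynomials of the statement.

  For the spectral form of the bifurcation, a non-real eigenvalue \<open>\<mu>\<close> of a real \<open>3 \<times> 3\<close> matrix whose
  third eigenvalue is \<open>r\<close> gives the factorisation
  \<open>D2_minus = (1 - \<bar>\<mu>\<bar>\<^sup>2) (1 - 2 r Re \<mu> + \<bar>\<mu>\<bar>\<^sup>2 r\<^sup>2)\<close>.  On the unit circle the second factor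
  is \<open>\<bar>\<mu> - r\<bar>\<^sup>2 > 0\<close>, so transversality of \<open>\<bar>\<mu>\<bar>\<close> passes to \<open>D2_minus\<close>.
\<close>

section \<open>Spectrum and \<open>D2_minus\<close> of real matrices of size 3\<close>

lemma charpoly_3:
  fixes A :: "'a::comm_ring_1 ^ 3 ^ 3"
  shows "charpoly A =
    [:- det A,
      A$1$1 * A$2$2 - A$1$2 * A$2$1 + (A$1$1 * A$3$3 - A$1$3 * A$3$1)
        + (A$2$2 * A$3$3 - A$2$3 * A$3$2),
      - (A$1$1 + A$2$2 + A$3$3), 1:]"
  by (simp add: charpoly_def det_3 mat_def algebra_simps)

text \<open>An eigenvector lies in the kernel of \<open>?B\<close>, so \<open>det ?B = 0\<close>;
  expanded, \<open>det ?B\<close> is minus the characteristic polynomial at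
  \<open>\<mu>\<close>.\<close>

lemma complex_eigenvalues_3_root:
  fixes A :: "real ^ 3 ^ 3"
  assumes "\<mu> \<in> complex_eigenvalues A"
  defines "a \<equiv> coeff (charpoly A)"
  shows "\<mu>^3 + of_real (a 2) * \<mu>^2 + of_real (a 1) * \<mu> + of_real (a 0) = 0"
proof -
  obtain w :: "complex ^ 3" where w: "w \<noteq> 0" "map_matrix complex_of_real A *v w = \<mu> *s w"
    using assms by (auto simp: complex_eigenvalues_def)
  let ?B = "map_matrix complex_of_real A - mat \<mu>"
  have "?B *v w = 0"
    using w(2) by (simp add: matrix_vector_mult_diff_rdistrib vec_eq_iff matrix_vector_mult_def
        mat_def forall_3 sum_3 algebra_simps)
  then have "det ?B = 0"
    using w(1) invertible_det_nz matrix_left_invertible_ker invertible_def by metis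
  then show ?thesis
    by (simp add: a_def charpoly_3 det_3 mat_def numeral_2_eq_2 numeral_3_eq_3 algebra_simps)
qed

text \<open>The trace gives the third eigenvalue \<open>r\<close>. The real and imaginary parts of
  the characteristic equation determine \<open>a 0\<close> and \<open>a 1\<close> from
  \<open>a 2\<close> and \<open>\<mu>\<close>, which leaves a polynomial identity.\<close>

lemma D2_minus_nonreal_eigenvalue:
  fixes A :: "real ^ 3 ^ 3"
  assumes "\<mu> \<in> complex_eigenvalues A" "Im \<mu> \<noteq> 0"
  defines "r \<equiv> - coeff (charpoly A) 2 - 2 * Re \<mu>"
  shows "D2_minus A = (1 - (cmod \<mu>)\<^sup>2) * (1 - 2 * Re \<mu> * r + (cmod \<mu>)\<^sup>2 * r\<^sup>2)"
proof -
  define a where "a = coeff (charpoly A)"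
  define p q where "p = Re \<mu>" and "q = Im \<mu>"
  have \<mu>: "\<mu> = Complex p q" by (simp add: p_def q_def)
  have q: "q \<noteq> 0" using assms by (simp add: q_def)
  have root: "\<mu>^3 + of_real (a 2) * \<mu>^2 + of_real (a 1) * \<mu> + of_real (a 0) = 0"
    using complex_eigenvalues_3_root[OF assms(1)] by (simp add: a_def)
  have re: "p^3 - 3*p*q^2 + a 2 * (p^2 - q^2) + a 1 * p + a 0 = 0"
    using arg_cong[OF root, of Re] by (simp add: \<mu> power2_eq_square power3_eq_cube algebra_simps)
  have "q * (3*p^2 - q^2 + 2 * a 2 * p + a 1) = 0"
    using arg_cong[OF root, of Im] by (simp add: \<mu> power2_eq_square power3_eq_cube algebra_simps)
  \<comment> \<open>Dividing the imaginary part by \<open>Im \<mu>\<close> leaves an equation linear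
    in \<open>a 1\<close>.\<close>
  with q have a1: "a 1 = q^2 - 3*p^2 - 2 * a 2 * p" by simp
  have a0: "a 0 = - (p^3) + 3*p*q^2 - a 2 * (p^2 - q^2) - a 1 * p" using re by simp
  have m: "(cmod \<mu>)\<^sup>2 = p^2 + q^2" by (simp add: cmod_power2 p_def q_def)
  show ?thesis
    unfolding D2_minus_def Let_def r_def m a_def[symmetric] p_def[symmetric] a0 a1
    by algebra
qed

text \<open>The branch \<open>ev\<close> is merely continuous and only its modulus is known to have
  partials. Hypothesis \<open>cont\<close> makes the third eigenvalue \<open>r\<close> continuous
  along each axis, hence also the cofactor \<open>h\<close>.\<close>

lemma neimark_sacker_nonzero_partials_D2_minus:
  assumes "neimark_sacker A u"
    and cont: "\<And>j. isCont (\<lambda>t. coeff (charpoly (A (u + t *\<^sub>R axis j 1))) 2) 0"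
  shows "nonzero_partials (\<lambda>v. D2_minus (A v)) u"
  unfolding nonzero_partials_def
proof
  fix j
  obtain U ev where U: "open U" "u \<in> U" "continuous_on U ev"
    and ev: "\<And>v. v \<in> U \<Longrightarrow> ev v \<in> complex_eigenvalues (A v)"
    and u: "Im (ev u) \<noteq> 0" "cmod (ev u) = 1"
    and part: "nonzero_partials (\<lambda>v. cmod (ev v)) u"
    using assms(1) unfolding neimark_sacker_def by blast
  define l where "l t = u + t *\<^sub>R axis j 1" for t :: real
  have l0: "l 0 = u" by (simp add: l_def)
  have lc: "isCont l 0" unfolding l_def by (intro continuous_intros)
  have evc: "isCont (\<lambda>t. ev (l t)) 0"
  proof (rule isCont_o2[OF lc])
    show "isCont ev (l 0)" using U by (simp add: l0 continuous_on_eq_continuous_at)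
  qed
  have rec: "isCont (\<lambda>t. Re (ev (l t))) 0" and imc: "isCont (\<lambda>t. Im (ev (l t))) 0"
    using evc by (auto intro: continuous_intros)
  define m where "m t = cmod (ev (l t))" for t
  obtain d where d: "d \<noteq> 0" "(m has_real_derivative d) (at 0)"
    using part unfolding nonzero_partials_def m_def l_def by blast
  have m0: "m 0 = 1" using u by (simp add: m_def l0)
  have mc: "isCont m 0" using d DERIV_isCont by blast
  define r where "r t = - coeff (charpoly (A (l t))) 2 - 2 * Re (ev (l t))" for t
  have rc: "isCont r 0"
    unfolding r_def using cont[of j] rec by (intro continuous_intros) (simp_all add: l_def)
  \<comment> \<open>The cofactor of \<open>m t - 1\<close> in \<open>D2_minus\<close>, using
    \<open>1 - m^2 = - (m - 1) * (1 + m)\<close>.\<close>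
  define h where "h t = - (1 + m t) * (1 - 2 * Re (ev (l t)) * r t + (m t)\<^sup>2 * (r t)\<^sup>2)" for t
  have hc: "isCont h 0"
    unfolding h_def using rec rc mc by (intro continuous_intros)
  have h0: "h 0 \<noteq> 0"
  proof -
    have "(Re (ev u))\<^sup>2 + (Im (ev u))\<^sup>2 = 1"
      using u by (simp flip: cmod_power2)
    then have "1 - 2 * Re (ev u) * r 0 + (r 0)\<^sup>2 = (Re (ev u) - r 0)\<^sup>2 + (Im (ev u))\<^sup>2"
      by algebra
    also have "\<dots> > 0" using u by (simp add: add_nonneg_pos)
    finally show ?thesis by (simp add: h_def m0 l0)
  qed
  \<comment> \<open>The product rule does not apply: \<open>h\<close> is only continuous at \<open>0\<close>, but \<open>m 0 - 1 = 0\<close>.\<close>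
  have "((\<lambda>t. (m t - 1) * h t) has_real_derivative d * h 0) (at 0)"
  proof -
    \<comment> \<open>Caratheodory slope of \<open>m\<close>; because \<open>m 0 = 1\<close>,
      \<open>g z * h z\<close> is a slope for the product.\<close>
    obtain g where g: "\<And>z. m z - m 0 = g z * (z - 0)" "isCont g 0" "g 0 = d"
      using d(2) unfolding CARAT_DERIV by blast
    show ?thesis
      unfolding CARAT_DERIV
    proof (intro exI conjI allI)
      show "(m z - 1) * h z - (m 0 - 1) * h 0 = (g z * h z) * (z - 0)" for z
        using g(1)[of z] by (simp add: m0)
      show "isCont (\<lambda>z. g z * h z) 0" using g hc by (intro continuous_intros)
      show "g 0 * h 0 = d * h 0" using g by simp
    qed
  qed
  moreover have "\<forall>\<^sub>F t in nhds 0. D2_minus (A (l t)) = (m t - 1) * h t"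
  proof -
    have "\<forall>\<^sub>F t in nhds 0. l t \<in> U"
      using lc U(1,2) l0 unfolding isCont_def tendsto_at_iff_tendsto_nhds
      by (auto dest: topological_tendstoD)
    \<comment> \<open>The factorisation requires a non-real eigenvalue on a whole neighbourhood,
      which continuity supplies.\<close>
    moreover have "\<forall>\<^sub>F t in nhds 0. Im (ev (l t)) \<noteq> 0"
    proof -
      have "((\<lambda>t. Im (ev (l t))) \<longlongrightarrow> Im (ev u)) (nhds 0)"
        using imc l0 by (simp add: isCont_def tendsto_nhds_iff)
      then show ?thesis using u tendsto_imp_eventually_ne by blast
    qed
    ultimately show ?thesis
    proof eventually_elim
      case (elim t)
      show ?case
        using D2_minus_nonreal_eigenvalue[OF ev[OF elim(1)] elim(2)]
        unfolding h_def m_def r_def by algebra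
    qed
  qed
  ultimately have "((\<lambda>t. D2_minus (A (l t))) has_real_derivative d * h 0) (at 0)"
    by (subst DERIV_cong_ev[OF refl _ refl]) auto
  then show "\<exists>d. d \<noteq> 0 \<and>
      ((\<lambda>t. D2_minus (A (u + t *\<^sub>R axis j 1))) has_real_derivative d) (at 0)"
    using d(1) h0 unfolding l_def by (intro exI[of _ "d * h 0"]) simp
qed

section \<open>The Jacobian of the LNB map at a general state\<close>

text \<open>Four numbers suffice: the first component differs from a function of
  \<open>x + y + z\<close> by \<open>x / 2\<close>, the second depends on \<open>x + z\<close>
  alone, and in the third \<open>x\<close> and \<open>y\<close> enter only through
  \<open>x + y\<close>.\<close>

definition LNB_matrix :: "real \<Rightarrow> real \<Rightarrow> real \<Rightarrow> real \<Rightarrow> real ^ 3 ^ 3" where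
  "LNB_matrix A C E F =
     vector [vector [A, A - 1/2, A - 1/2], vector [C, 0, C], vector [E, E, F]]"

definition LNB_jacobian_matrix :: "real ^ 4 \<Rightarrow> real ^ 3 \<Rightarrow> real ^ 3 ^ 3" where
  "LNB_jacobian_matrix u p =
     (let k = u $ 1; c1 = u $ 2; c2 = u $ 3; c3 = u $ 4; x = p $ 1; y = p $ 2; z = p $ 3;
          S = x + y + z; A = 1 - c1 * S; C = 1 / (2 * c2 * sqrt ((x + z) / c2)) - 1;
          E = k * z * (1 / S\<^sup>2 - 2 * (x + y) / S^3);
          F = 1 + k * ((x + y) / S\<^sup>2 - c3) - 2 * k * z * (x + y) / S^3
      in LNB_matrix A C E F)"

text \<open>Componentwise differentiation; the hypotheses keep the square root's argument positive
  and the denominators nonzero.\<close>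

lemma LNB_jacobian_eq:
  assumes "p $ 1 + p $ 3 > 0" "p $ 1 + p $ 2 + p $ 3 \<noteq> 0" "u $ 3 > 0"
  shows "LNB_jacobian u p = LNB_jacobian_matrix u p"
proof -
  have "(LNB_map u has_derivative (\<lambda>h. LNB_jacobian_matrix u p *v h)) (at p)"
  proof (rule has_derivative_componentwise_within[THEN iffD2], rule)
    fix b :: "real ^ 3" assume "b \<in> Basis"
    then obtain i where b: "b = axis i 1" by (auto simp: Basis_vec_def)
    have nth: "((\<lambda>p. p $ j) has_derivative (\<lambda>h. h $ j)) (at p)" for j
      by (rule bounded_linear_imp_has_derivative) (rule bounded_linear_vec_nth)
    define S where "S = p $ 1 + p $ 2 + p $ 3"
    have S: "S \<noteq> 0" using assms by (simp add: S_def)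
    have R: "(p $ 1 + p $ 3) / u $ 3 > 0" "u $ 3 \<noteq> 0" using assms by simp_all
    have S2: "(p $ 1 + p $ 2 + p $ 3)\<^sup>2 \<noteq> 0" using assms by simp
    have "((\<lambda>p. LNB_map u p $ i) has_derivative (\<lambda>h. (LNB_jacobian_matrix u p *v h) $ i)) (at p)"
    proof -
      have 1: "((\<lambda>p. LNB_map u p $ 1) has_derivative (\<lambda>h. (LNB_jacobian_matrix u p *v h) $ 1)) (at p)"
        unfolding LNB_map_def Let_def vector_3
        by (rule nth derivative_eq_intros refl)+
          (auto simp: LNB_jacobian_matrix_def LNB_matrix_def Let_def matrix_vector_mult_def
            sum_3 algebra_simps)
      have 2: "((\<lambda>p. LNB_map u p $ 2) has_derivative (\<lambda>h. (LNB_jacobian_matrix u p *v h) $ 2)) (at p)"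
        unfolding LNB_map_def Let_def vector_3
        by (rule nth R has_derivative_real_sqrt derivative_eq_intros refl)+
          (use R in \<open>simp_all add: LNB_jacobian_matrix_def LNB_matrix_def Let_def matrix_vector_mult_def
            sum_3 field_simps, simp add: add_divide_distrib\<close>)
      have 3: "((\<lambda>p. LNB_map u p $ 3) has_derivative (\<lambda>h. (LNB_jacobian_matrix u p *v h) $ 3)) (at p)"
        unfolding LNB_map_def Let_def vector_3
        by (rule nth S2 derivative_eq_intros refl)+
          (use S in \<open>simp add: LNB_jacobian_matrix_def LNB_matrix_def Let_def matrix_vector_mult_def
            sum_3 flip: S_def, simp add: fun_eq_iff field_simps power2_eq_square power3_eq_cube\<close>)
      show ?thesis using 1 2 3 exhaust_3[of i] by auto
    qed
    then show "((\<lambda>p. LNB_map u p \<bullet> b) has_derivative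
        (\<lambda>h. (LNB_jacobian_matrix u p *v h) \<bullet> b)) (at p)"
      by (simp add: b inner_axis)
  qed
  then show ?thesis
    unfolding LNB_jacobian_def jacobian_def
    by (simp flip: frechet_derivative_at)
qed

section \<open>Characteristic coefficients as functions of the four entries\<close>

text \<open>
  Constant and linear coefficient of the characteristic polynomial of \<open>LNB_matrix A C E F\<close>; \<open>dchar0\<close>
  and \<open>dchar1\<close> below are their differentials.
\<close>

definition char0 :: "real \<Rightarrow> real \<Rightarrow> real \<Rightarrow> real \<Rightarrow> real" where
  "char0 A C E F = C * ((A - 1/2) * F + (1 - A) * E)"

definition char1 :: "real \<Rightarrow> real \<Rightarrow> real \<Rightarrow> real \<Rightarrow> real" where
  "char1 A C E F = A * F - (A - 1/2) * E - C * ((A - 1/2) + E)"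

text \<open>The quadratic coefficient is \<open>- (A + F)\<close>, hence the sign of the second
  term.\<close>

definition char_D2 :: "real \<Rightarrow> real \<Rightarrow> real \<Rightarrow> real \<Rightarrow> real" where
  "char_D2 A C E F = - (char0 A C E F)\<^sup>2 - char0 A C E F * (A + F) - char1 A C E F + 1"

definition dchar0 where
  "dchar0 A C E F dA dC dE dF =
     dC * ((A - 1/2) * F + (1 - A) * E) + C * (dA * (F - E) + dF * (A - 1/2) + dE * (1 - A))"

definition dchar1 where
  "dchar1 A C E F dA dC dE dF =
     dA * (F - E - C) + A * dF - dE * (A - 1/2 + C) - dC * (A - 1/2 + E)"

lemma char_D2_has_derivative:
  fixes A C E F :: "real \<Rightarrow> real"
  assumes "(A has_real_derivative dA) (at t)" "(C has_real_derivative dC) (at t)"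
    "(E has_real_derivative dE) (at t)" "(F has_real_derivative dF) (at t)"
  shows "((\<lambda>t. char_D2 (A t) (C t) (E t) (F t)) has_real_derivative
     - dchar0 (A t) (C t) (E t) (F t) dA dC dE dF * (2 * char0 (A t) (C t) (E t) (F t) + A t + F t)
     - char0 (A t) (C t) (E t) (F t) * (dA + dF) - dchar1 (A t) (C t) (E t) (F t) dA dC dE dF) (at t)"
  unfolding char_D2_def char0_def char1_def dchar0_def dchar1_def
  by (rule derivative_eq_intros assms refl)+ (simp, algebra)

lemma charpoly_LNB_matrix:
  "coeff (charpoly (LNB_matrix A C E F)) 2 = - (A + F)"
  "D2_minus (LNB_matrix A C E F) = char_D2 A C E F"
proof -
  show "coeff (charpoly (LNB_matrix A C E F)) 2 = - (A + F)"
    by (simp add: LNB_matrix_def charpoly_3 numeral_2_eq_2)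
  show "D2_minus (LNB_matrix A C E F) = char_D2 A C E F"
    by (simp add: LNB_matrix_def D2_minus_def Let_def charpoly_3 det_3 char_D2_def char0_def
        char1_def numeral_2_eq_2) algebra
qed

section \<open>Polynomial identities at the equilibrium\<close>

locale LNB_admissible_point =
  fixes u :: "real ^ 4"
  assumes admissible: "LNB_admissible u"
begin

abbreviation k where "k \<equiv> u $ 1"
abbreviation c1 where "c1 \<equiv> u $ 2"
abbreviation c2 where "c2 \<equiv> u $ 3"
abbreviation c3 where "c3 \<equiv> u $ 4"

definition s where "s = c1 + c2 + c3"
text \<open>Entries at \<open>E2\<close>, where \<open>x + y + z = 2 / s\<close>,
  \<open>x + z = 4 * c2 / s^2\<close> and \<open>x + y = 4 * c3 / s^2\<close>.\<close>

definition A where "A = 1 - 2 * c1 / s"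
definition C where "C = s / (4 * c2) - 1"
definition E where "E = k * (s - 2 * c3) * (s - 4 * c3) / (2 * s)"
definition F where "F = 1 - 2 * k * c3 * (s - 2 * c3) / s"

lemma params_pos: "k > 0" "c1 > 0" "c2 > 0" "c3 > 0" "s > 0"
  using admissible by (auto simp: LNB_admissible_def s_def add_pos_pos)

lemma params_nonzero: "k \<noteq> 0" "c2 \<noteq> 0" "s \<noteq> 0" using params_pos by simp_all

text \<open>Clearing denominators coefficient by coefficient leaves only division-free identities
  for the comparison with the explicit polynomials.\<close>

lemma char0_eq: "8 * c2 * s * char0 A C E F
    = (s - 4 * c2) * (s - 4 * c1 + 2 * k * (s - 2 * c3) * (c1 - c3))"
  using params_nonzero unfolding char0_def A_def C_def E_def F_def
  by (simp add: field_simps)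

lemma char1_eq: "8 * c2 * s * char1 A C E F
    = 8 * c2 * (s - 2 * c1) + 2 * c2 * k * (s - 2 * c3) * (4 * c1 - 4 * c3 - s)
      - (s - 4 * c2) * (s - 4 * c1 + k * (s - 2 * c3) * (s - 4 * c3))"
  using params_nonzero unfolding char1_def A_def C_def E_def F_def
  by (simp add: field_simps)

lemma trace_eq: "8 * c2 * s * (A + F) = 16 * c2 * (s - c1 - k * c3 * (s - 2 * c3))"
  using params_nonzero unfolding A_def F_def
  by (simp add: field_simps)

text \<open>In the quadratic terms each factor absorbs one copy of \<open>8 * c2 * s\<close>; the
  linear term keeps a spare copy.\<close>

lemma char_D2_NS_LNB: "64 * c2\<^sup>2 * s\<^sup>2 * char_D2 A C E F = - NS_LNB u"
proof -
  have "64 * c2\<^sup>2 * s\<^sup>2 * char_D2 A C E F =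
      - (8 * c2 * s * char0 A C E F)\<^sup>2 - (8 * c2 * s * char0 A C E F) * (8 * c2 * s * (A + F))
      - 8 * c2 * s * (8 * c2 * s * char1 A C E F) + 64 * c2\<^sup>2 * s\<^sup>2"
    unfolding char_D2_def by algebra
  also have "\<dots> = - NS_LNB u"
    unfolding char0_eq char1_eq trace_eq NS_LNB_def Let_def unfolding s_def by algebra
  finally show ?thesis .
qed

text \<open>\<open>e\<close> and \<open>f\<close> are the \<open>k\<close>-derivatives of the
  entries \<open>E\<close> and \<open>F\<close>; \<open>A\<close> and \<open>C\<close> are
  independent of \<open>k\<close>.\<close>

lemma dchar_k:
  defines "e \<equiv> (s - 2 * c3) * (s - 4 * c3) / (2 * s)" and "f \<equiv> - (2 * c3 * (s - 2 * c3) / s)"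
  shows "8 * c2 * s * dchar0 A C E F 0 0 e f = 2 * (s - 4 * c2) * (s - 2 * c3) * (c1 - c3)"
    and "8 * c2 * s * dchar1 A C E F 0 0 e f
      = 2 * c2 * (s - 2 * c3) * (4 * c1 - 4 * c3 - s) - (s - 4 * c2) * (s - 2 * c3) * (s - 4 * c3)"
    and "8 * c2 * s * f = - (16 * c2 * c3 * (s - 2 * c3))"
  using params_nonzero unfolding dchar0_def dchar1_def A_def C_def E_def F_def e_def f_def
  by (simp_all add: field_simps)

lemma dchar_c1:
  defines "a \<equiv> - (2 / s)"
  shows "8 * c2 * s * dchar0 A C E F a 0 0 0 = - (2 * (s - 4 * c2) * (2 - k * (s - 2 * c3)))"
    and "8 * c2 * s * dchar1 A C E F a 0 0 0 = - (8 * c2 * (2 - k * (s - 2 * c3))) + 4 * (s - 4 * c2)"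
    and "8 * c2 * s * a = - (16 * c2)"
  using params_nonzero unfolding dchar0_def dchar1_def A_def C_def E_def F_def a_def
  by (simp_all add: field_simps)

text \<open>With the state frozen the entry is \<open>s / (4 * sqrt (c2 * v $ 3)) - 1\<close>, so
  the increment is half of what \<open>s / (4 * c2)\<close> would give at fixed \<open>s\<close>.
  Its factor \<open>s\<close> cancels the denominator \<open>s\<close>, so \<open>16 * c2^2\<close>
  clears everything.\<close>

lemma dchar_c2:
  defines "c \<equiv> - (s / (8 * c2\<^sup>2))"
  shows "16 * c2\<^sup>2 * dchar0 A C E F 0 c 0 0 = - (s - 4 * c1 + 2 * k * (s - 2 * c3) * (c1 - c3))"
    and "16 * c2\<^sup>2 * dchar1 A C E F 0 c 0 0 = s - 4 * c1 + k * (s - 2 * c3) * (s - 4 * c3)"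
  using params_nonzero unfolding dchar0_def dchar1_def A_def C_def E_def F_def c_def
  by (simp_all add: field_simps power2_eq_square)

text \<open>The bracket \<open>(x + y) / (x + y + z)^2 - c3\<close> vanishes at \<open>E2\<close>
  but, at frozen state, contributes \<open>- k\<close> to the derivative of the entry
  \<open>F\<close>.\<close>

lemma dchar_c3:
  shows "8 * c2 * s * dchar0 A C E F 0 0 0 (- k) = - (k * (s - 4 * c2) * (s - 4 * c1))"
    and "8 * c2 * s * dchar1 A C E F 0 0 0 (- k) = - (8 * k * c2 * (s - 2 * c1))"
  using params_nonzero unfolding dchar0_def dchar1_def A_def C_def E_def F_def
  by (simp_all add: field_simps)

definition dD2 where
  "dD2 dA dC dE dF = - dchar0 A C E F dA dC dE dF * (2 * char0 A C E F + A + F)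
     - char0 A C E F * (dA + dF) - dchar1 A C E F dA dC dE dF"

lemma dD2_scaled: "64 * c2\<^sup>2 * s\<^sup>2 * dD2 dA dC dE dF =
    - (8 * c2 * s * dchar0 A C E F dA dC dE dF) * (2 * (8 * c2 * s * char0 A C E F) + 8 * c2 * s * (A + F))
    - (8 * c2 * s * char0 A C E F) * (8 * c2 * s * dA + 8 * c2 * s * dF)
    - 8 * c2 * s * (8 * c2 * s * dchar1 A C E F dA dC dE dF)"
  unfolding dD2_def by algebra

lemma dD2_k:
  "64 * c2\<^sup>2 * s\<^sup>2 * dD2 0 0 ((s - 2 * c3) * (s - 4 * c3) / (2 * s)) (- (2 * c3 * (s - 2 * c3) / s))
    = - (4 * (c1 + c2 - c3) * NT_LNB_k u)"
  unfolding dD2_scaled dchar_k char0_eq trace_eq NT_LNB_k_def Let_def unfolding s_def by algebra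

lemma dD2_c1:
  "64 * c2\<^sup>2 * s\<^sup>2 * dD2 (- (2 / s)) 0 0 0 = - (4 * NT_LNB_c1 u)"
  unfolding dD2_scaled dchar_c1 char0_eq trace_eq NT_LNB_c1_def Let_def unfolding s_def by algebra

lemma dD2_c2:
  "64 * c2^3 * s * dD2 0 (- (s / (8 * c2\<^sup>2))) 0 0 = NT_LNB_c2 u"
proof -
  \<comment> \<open>The doubled scale is the product of \<open>16 * c2^2\<close> and
    \<open>8 * c2 * s\<close>, the scales of the increments and of the coefficients.\<close>
  have "64 * c2^3 * s * dD2 0 (- (s / (8 * c2\<^sup>2))) 0 0 * 2 =
    - (16 * c2\<^sup>2 * dchar0 A C E F 0 (- (s / (8 * c2\<^sup>2))) 0 0)
        * (2 * (8 * c2 * s * char0 A C E F) + 8 * c2 * s * (A + F))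
    - 8 * c2 * s * (16 * c2\<^sup>2 * dchar1 A C E F 0 (- (s / (8 * c2\<^sup>2))) 0 0)"
    unfolding dD2_def by algebra
  also have "\<dots> = NT_LNB_c2 u * 2"
    unfolding dchar_c2 char0_eq trace_eq NT_LNB_c2_def Let_def unfolding s_def by algebra
  finally show ?thesis by linarith
qed

lemma dD2_c3:
  "64 * c2\<^sup>2 * s\<^sup>2 * dD2 0 0 0 (- k) = - (2 * k * NT_LNB_c3 u)"
  unfolding dD2_scaled dchar_c3 char0_eq trace_eq NT_LNB_c3_def Let_def unfolding s_def by algebra

section \<open>The Jacobian family with frozen state and its partial derivatives\<close>

lemma LNB_E2_sums:
  "LNB_E2 u $ 1 + LNB_E2 u $ 2 + LNB_E2 u $ 3 = 2 / s"
  "LNB_E2 u $ 1 + LNB_E2 u $ 3 = 4 * c2 / s\<^sup>2"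
  "LNB_E2 u $ 1 + LNB_E2 u $ 2 = 4 * c3 / s\<^sup>2"
  "LNB_E2 u $ 3 = 2 * (s - 2 * c3) / s\<^sup>2"
proof -
  have E: "LNB_E2 u $ 1 = 2 * (s - 2 * c1) / s\<^sup>2" "LNB_E2 u $ 2 = 2 * (s - 2 * c2) / s\<^sup>2"
    "LNB_E2 u $ 3 = 2 * (s - 2 * c3) / s\<^sup>2"
    by (simp_all add: LNB_E2_def Let_def s_def algebra_simps)
  have "LNB_E2 u $ 1 + LNB_E2 u $ 2 + LNB_E2 u $ 3 = 2 * (3 * s - 2 * (c1 + c2 + c3)) / s\<^sup>2"
    by (simp add: E add_divide_distrib[symmetric] algebra_simps)
  then show "LNB_E2 u $ 1 + LNB_E2 u $ 2 + LNB_E2 u $ 3 = 2 / s"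
    using params_nonzero by (simp flip: s_def add: power2_eq_square)
  show "LNB_E2 u $ 1 + LNB_E2 u $ 3 = 4 * c2 / s\<^sup>2" "LNB_E2 u $ 1 + LNB_E2 u $ 2 = 4 * c3 / s\<^sup>2"
    by (simp_all add: E s_def add_divide_distrib[symmetric] algebra_simps)
qed (simp add: LNB_E2_def Let_def s_def algebra_simps)

text \<open>
  Entries of the Jacobian at the parameters \<open>v\<close>, with the state held at \<open>LNB_E2 u\<close>.
\<close>

definition entry_A where "entry_A v = 1 - 2 * (v $ 2) / s" for v :: "real ^ 4"
definition entry_C where "entry_C v = s / (4 * sqrt (c2 * v $ 3)) - 1" for v :: "real ^ 4"
definition entry_E where
  "entry_E v = v $ 1 * (s - 2 * c3) * (s - 4 * c3) / (2 * s)" for v :: "real ^ 4"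
definition entry_F where
  "entry_F v = 1 + v $ 1 * (c3 - v $ 4) - 2 * v $ 1 * c3 * (s - 2 * c3) / s" for v :: "real ^ 4"

lemma entries_at_u: "entry_A u = A" "entry_C u = C" "entry_E u = E" "entry_F u = F"
  using params_pos by (simp_all add: entry_A_def A_def entry_C_def C_def entry_E_def E_def entry_F_def F_def)

lemma LNB_jacobian_family_eq:
  assumes "v $ 3 > 0"
  shows "LNB_jacobian_family u v = LNB_matrix (entry_A v) (entry_C v) (entry_E v) (entry_F v)"
proof -
  have 2: "v $ 3 * sqrt (4 * c2 / s\<^sup>2 / v $ 3) = 2 * sqrt (c2 * v $ 3) / s"
  proof -
    have "v $ 3 = sqrt ((v $ 3)\<^sup>2)" using assms by simp
    then have "v $ 3 * sqrt (4 * c2 / s\<^sup>2 / v $ 3) = sqrt ((v $ 3)\<^sup>2 * (4 * c2 / s\<^sup>2 / v $ 3))"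
      by (metis real_sqrt_mult)
    also have "(v $ 3)\<^sup>2 * (4 * c2 / s\<^sup>2 / v $ 3) = (2 / s)\<^sup>2 * (c2 * v $ 3)"
      using assms by (simp add: field_simps power2_eq_square)
    finally show ?thesis using params_pos by (simp add: real_sqrt_mult)
  qed
  have C: "1 / (2 * v $ 3 * sqrt (4 * c2 / s\<^sup>2 / v $ 3)) - 1 = entry_C v"
    unfolding entry_C_def mult.assoc 2 using params_nonzero by simp
  have E: "v $ 1 * (2 * (s - 2 * c3) / s\<^sup>2) * (1 / (2 / s)\<^sup>2 - 2 * (4 * c3 / s\<^sup>2) / (2 / s)^3) = entry_E v"
    using params_nonzero unfolding entry_E_def by (simp add: field_simps power2_eq_square power3_eq_cube)
  have F: "1 + v $ 1 * (4 * c3 / s\<^sup>2 / (2 / s)\<^sup>2 - v $ 4)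
      - 2 * v $ 1 * (2 * (s - 2 * c3) / s\<^sup>2) * (4 * c3 / s\<^sup>2) / (2 / s)^3 = entry_F v"
    using params_nonzero unfolding entry_F_def by (simp add: field_simps power2_eq_square power3_eq_cube)
  have A: "1 - v $ 2 * (2 / s) = entry_A v" by (simp add: entry_A_def)
  have "LNB_jacobian_family u v = LNB_jacobian_matrix v (LNB_E2 u)"
    unfolding LNB_jacobian_family_def
    by (rule LNB_jacobian_eq) (use params_pos assms in \<open>simp_all add: LNB_E2_sums(1,2)\<close>)
  also have "\<dots> = LNB_matrix (entry_A v) (entry_C v) (entry_E v) (entry_F v)"
    \<comment> \<open>Longer sums go first: \<open>x + y\<close> is a subterm of
      \<open>x + y + z\<close>, and \<open>z\<close> occurs in both \<open>x + z\<close> and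
      \<open>x + y + z\<close>.\<close>
    unfolding LNB_jacobian_matrix_def Let_def LNB_E2_sums(1) unfolding LNB_E2_sums(2,3)
    unfolding LNB_E2_sums(4) C E F A by (rule refl)
  finally show ?thesis .
qed

lemma D2_minus_LNB_jacobian: "D2_minus (LNB_jacobian u (LNB_E2 u)) = char_D2 A C E F"
  using LNB_jacobian_family_eq[of u] params_pos by (simp add: LNB_jacobian_family_def charpoly_LNB_matrix entries_at_u)

text \<open>Positivity of the third parameter persists near \<open>u\<close>, which suffices for
  derivatives and continuity at \<open>u\<close>.\<close>

lemma eventually_LNB_jacobian_family_eq:
  "\<forall>\<^sub>F t in nhds 0. LNB_jacobian_family u (u + t *\<^sub>R axis j 1) =
    (let v = u + t *\<^sub>R axis j 1 in LNB_matrix (entry_A v) (entry_C v) (entry_E v) (entry_F v))"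
proof -
  have "isCont (\<lambda>t. (u + t *\<^sub>R axis j 1) $ 3) 0"
    by (intro continuous_intros)
  then have "((\<lambda>t. (u + t *\<^sub>R axis j 1) $ 3) \<longlongrightarrow> c2) (nhds 0)"
    by (simp add: isCont_def tendsto_nhds_iff)
  then have "\<forall>\<^sub>F t in nhds 0. (u + t *\<^sub>R axis j 1) $ 3 > 0"
    using params_pos(3) by (rule order_tendstoD)
  then show ?thesis
    by eventually_elim (simp add: LNB_jacobian_family_eq Let_def)
qed

lemma entries_have_derivative:
  defines "l j t \<equiv> u + t *\<^sub>R axis j 1"
  shows "((\<lambda>t. entry_A (l j t)) has_real_derivative (if j = 2 then - (2 / s) else 0)) (at 0)"
    and "((\<lambda>t. entry_C (l j t)) has_real_derivative (if j = 3 then - (s / (8 * c2\<^sup>2)) else 0)) (at 0)"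
    and "((\<lambda>t. entry_E (l j t)) has_real_derivative
      (if j = 1 then (s - 2 * c3) * (s - 4 * c3) / (2 * s) else 0)) (at 0)"
    and "((\<lambda>t. entry_F (l j t)) has_real_derivative
      (if j = 1 then - (2 * c3 * (s - 2 * c3) / s) else if j = 4 then - k else 0)) (at 0)"
proof -
  show "((\<lambda>t. entry_A (l j t)) has_real_derivative (if j = 2 then - (2 / s) else 0)) (at 0)"
    using params_nonzero unfolding entry_A_def l_def by (auto simp: axis_def intro!: derivative_eq_intros)
  show "((\<lambda>t. entry_C (l j t)) has_real_derivative (if j = 3 then - (s / (8 * c2\<^sup>2)) else 0)) (at 0)"
  proof (cases "j = 3")
    case True
    have "((\<lambda>t. s / (4 * sqrt (c2 * (c2 + t))) - 1) has_real_derivative - (s / (8 * c2\<^sup>2))) (at 0)"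
      using params_pos by (auto simp: field_simps power2_eq_square intro!: derivative_eq_intros)
    then show ?thesis using True by (simp add: entry_C_def l_def axis_def)
  qed (auto simp: axis_def entry_C_def l_def)
  show "((\<lambda>t. entry_E (l j t)) has_real_derivative
      (if j = 1 then (s - 2 * c3) * (s - 4 * c3) / (2 * s) else 0)) (at 0)"
    using params_nonzero unfolding entry_E_def l_def by (auto simp: axis_def field_simps intro!: derivative_eq_intros)
  show "((\<lambda>t. entry_F (l j t)) has_real_derivative
      (if j = 1 then - (2 * c3 * (s - 2 * c3) / s) else if j = 4 then - k else 0)) (at 0)"
    using params_nonzero unfolding entry_F_def l_def by (auto simp: axis_def intro!: derivative_eq_intros)
qed

lemma D2_minus_family_has_derivative:
  "((\<lambda>t. D2_minus (LNB_jacobian_family u (u + t *\<^sub>R axis j 1))) has_real_derivative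
     dD2 (if j = 2 then - (2 / s) else 0) (if j = 3 then - (s / (8 * c2\<^sup>2)) else 0)
       (if j = 1 then (s - 2 * c3) * (s - 4 * c3) / (2 * s) else 0)
       (if j = 1 then - (2 * c3 * (s - 2 * c3) / s) else if j = 4 then - k else 0)) (at 0)"
proof -
  have "\<forall>\<^sub>F t in nhds 0. D2_minus (LNB_jacobian_family u (u + t *\<^sub>R axis j 1)) =
      char_D2 (entry_A (u + t *\<^sub>R axis j 1)) (entry_C (u + t *\<^sub>R axis j 1)) (entry_E (u + t *\<^sub>R axis j 1))
        (entry_F (u + t *\<^sub>R axis j 1))"
    using eventually_LNB_jacobian_family_eq[of j] by eventually_elim (simp add: Let_def charpoly_LNB_matrix)
  with char_D2_has_derivative[OF entries_have_derivative[of j]] show ?thesis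
    by (subst DERIV_cong_ev[OF refl _ refl]) (auto simp: entries_at_u dD2_def)
qed

text \<open>Supplies the hypothesis \<open>cont\<close> of
  \<open>neimark_sacker_nonzero_partials_D2_minus\<close>.\<close>

lemma isCont_trace_family:
  "isCont (\<lambda>t. coeff (charpoly (LNB_jacobian_family u (u + t *\<^sub>R axis j 1))) 2) 0"
proof -
  have "\<forall>\<^sub>F t in nhds 0. coeff (charpoly (LNB_jacobian_family u (u + t *\<^sub>R axis j 1))) 2 =
      - (entry_A (u + t *\<^sub>R axis j 1) + entry_F (u + t *\<^sub>R axis j 1))"
    using eventually_LNB_jacobian_family_eq[of j] by eventually_elim (simp add: Let_def charpoly_LNB_matrix)
  moreover have "isCont (\<lambda>t. - (entry_A (u + t *\<^sub>R axis j 1) + entry_F (u + t *\<^sub>R axis j 1))) 0"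
    using entries_have_derivative(1,4)[of j, THEN DERIV_isCont] by (intro continuous_intros)
  ultimately show ?thesis by (subst isCont_cong)
qed

lemma NT_LNB_nonzero:
  assumes "nonzero_partials (\<lambda>v. D2_minus (LNB_jacobian_family u v)) u"
  shows "NT_LNB_k u \<noteq> 0 \<and> NT_LNB_c1 u \<noteq> 0 \<and> NT_LNB_c2 u \<noteq> 0 \<and> NT_LNB_c3 u \<noteq> 0"
proof -
  have nonzero: "dD2 (if j = 2 then - (2 / s) else 0) (if j = 3 then - (s / (8 * c2\<^sup>2)) else 0)
       (if j = 1 then (s - 2 * c3) * (s - 4 * c3) / (2 * s) else 0)
       (if j = 1 then - (2 * c3 * (s - 2 * c3) / s) else if j = 4 then - k else 0) \<noteq> 0" for j :: 4
    using assms D2_minus_family_has_derivative[of j] DERIV_unique unfolding nonzero_partials_def by blast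
  \<comment> \<open>A vanishing polynomial would annihilate the scaled partial derivative, whose
    scale is built from the nonzero \<open>c2\<close> and \<open>s\<close>.\<close>
  show ?thesis
    using nonzero[of 1] nonzero[of 2] nonzero[of 3] nonzero[of 4] dD2_k dD2_c1 dD2_c2 dD2_c3 params_nonzero
    by auto
qed

end

theorem theorem7:
  shows "{u. LNB_admissible u \<and> D2_minus (LNB_jacobian u (LNB_E2 u)) = 0} =
         {u. LNB_admissible u \<and> NS_LNB u = 0} \<and>
         (\<forall>u. LNB_admissible u \<and>
            (neimark_sacker (LNB_jacobian_family u) u \<or>
             neimark_sacker_criterion (LNB_jacobian_family u) u) \<longrightarrow>
            NT_LNB_k u \<noteq> 0 \<and> NT_LNB_c1 u \<noteq> 0 \<and> NT_LNB_c2 u \<noteq> 0 \<and> NT_LNB_c3 u \<noteq> 0)"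
proof (intro conjI allI impI)
  show "{u. LNB_admissible u \<and> D2_minus (LNB_jacobian u (LNB_E2 u)) = 0} =
      {u. LNB_admissible u \<and> NS_LNB u = 0}"
  proof (rule Collect_cong, rule conj_cong[OF refl])
    fix u assume "LNB_admissible u"
    then interpret LNB_admissible_point u by unfold_locales
    show "D2_minus (LNB_jacobian u (LNB_E2 u)) = 0 \<longleftrightarrow> NS_LNB u = 0"
      using char_D2_NS_LNB params_nonzero by (auto simp: D2_minus_LNB_jacobian)
  qed
next
  fix u
  assume *: "LNB_admissible u \<and>
    (neimark_sacker (LNB_jacobian_family u) u \<or>
     neimark_sacker_criterion (LNB_jacobian_family u) u)"
  then interpret LNB_admissible_point u by unfold_locales simp
  \<comment> \<open>The coefficient criterion contains this condition; the spectral form yields it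
    by transfer from \<open>cmod (ev v)\<close>.\<close>
  have "nonzero_partials (\<lambda>v. D2_minus (LNB_jacobian_family u v)) u"
    using * neimark_sacker_nonzero_partials_D2_minus[OF _ isCont_trace_family]
    by (auto simp: neimark_sacker_criterion_def Let_def)
  then show "NT_LNB_k u \<noteq> 0" "NT_LNB_c1 u \<noteq> 0" "NT_LNB_c2 u \<noteq> 0" "NT_LNB_c3 u \<noteq> 0"
    using NT_LNB_nonzero by auto
qed

end
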